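(* Let $\mathbf{C}$ be a dagger monoidal category. Then $\mathrm{CP}^\infty(\mathbf{C})$ (the objects, morphisms, identities and composition defined in the context) is a well-defined category: the composition does not depend on the chosen representatives, it is associative, and the specified identity morphisms are neutral for composition.
   Context: A dagger monoidal category is a monoidal category $\mathbf{C}$ with an identity-on-objects involutive contravariant functor $f\mapsto f^\dagger$ satisfying $(f\otimes g)^\dagger=f^\dagger\otimes g^\dagger$, whose coherence isomorphisms $\alpha_{A,B,C}\colon (A\otimes B)\otimes C\to A\otimes(B\otimes C)$, $\lambda_A\colon I\otimes A\to A$, $\rho_A\colon A\otimes I\to A$ are unitary (inverse equals dagger). Equivalence relation. For morphisms $f\colon A\to X\otimes B$ and $g\colon A\to X'\otimes B$ of $\mathbf{C}$ (with $X,X'$ arbitrary objects), write $f\sim g$ when, for all objects $Y,Z$ and all $h\colon B\otimes Y\to Z$ in $\mathbf{C}$, suppressing associators, $$(f^\dagger\otimes 1_Y)(1_X\otimes h^\dagger h)(f\otimes 1_Y)=(g^\dagger\otimes 1_Y)(1_{X'}\otimes h^\dagger h)(g\otimes 1_Y)\colon A\otimes Y\to A\otimes Y .$$ $\mathrm{CP}^\infty(\mathbf{C})$: the objects are those of $\mathbf{C}$; the morphisms $A\to B$ are the $\sim$-equivalence classes $[f]$ of morphisms $f\colon A\to X\otimes B$ of $\mathbf{C}$, where $X$ ranges over all objects of $\mathbf{C}$. The identity on $A$ is $[\lambda_A^\dagger]$, the class of the coherence isomorphism $A\to I\otimes A$. The composite of $[f]\colon A\to B$, with $f\colon A\to X\otimes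 B$, and $[g]\colon B\to C$, with $g\colon B\to Y\otimes C$, is $$[g]\circ[f]=[\alpha_{X,Y,C}^\dagger(1_X\otimes g)f],$$ represented by a morphism $A\to (X\otimes Y)\otimes C$. Hom-collections of the resulting category are allowed to be large. *)

theory Defs
  imports Main
begin

record ('o, 'm) cat =
  obj :: "'o set"
  arr :: "'m set"
  source :: "'m \<Rightarrow> 'o"
  target :: "'m \<Rightarrow> 'o"
  ident :: "'o \<Rightarrow> 'm" ("\<one>\<index>")
  comp :: "'m \<Rightarrow> 'm \<Rightarrow> 'm" (infixr "\<cdot>\<index>" 70)

definition hom :: "('o, 'm, 'z) cat_scheme \<Rightarrow> 'o \<Rightarrow> 'o \<Rightarrow> 'm set" where
  "hom C A B = {f \<in> arr C. source C f = A \<and> target C f = B}"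

text \<open>\<open>g \<cdot> f\<close> is \<open>g\<close> after \<open>f\<close>. Nothing is assumed about the values of the
  operations outside \<open>obj C\<close> and \<open>arr C\<close>, or on non-composable pairs.\<close>

locale category =
  fixes C (structure)
  assumes source_obj: "f \<in> arr C \<Longrightarrow> source C f \<in> obj C"
    and target_obj: "f \<in> arr C \<Longrightarrow> target C f \<in> obj C"
    and ident_hom: "A \<in> obj C \<Longrightarrow> \<one> A \<in> hom C A A"
    and comp_hom: "\<lbrakk>f \<in> hom C A B; g \<in> hom C B D\<rbrakk> \<Longrightarrow> g \<cdot> f \<in> hom C A D"
    and comp_assoc: "\<lbrakk>f \<in> hom C A B; g \<in> hom C B D; h \<in> hom C D E\<rbrakk>
      \<Longrightarrow> (h \<cdot> g) \<cdot> f = h \<cdot> (g \<cdot> f)"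
    and ident_comp: "f \<in> hom C A B \<Longrightarrow> \<one> B \<cdot> f = f"
    and comp_ident: "f \<in> hom C A B \<Longrightarrow> f \<cdot> \<one> A = f"

definition iso_arr :: "('o, 'm, 'z) cat_scheme \<Rightarrow> 'm \<Rightarrow> bool" where
  "iso_arr C f \<longleftrightarrow> f \<in> arr C \<and> (\<exists>g \<in> hom C (target C f) (source C f).
      g \<cdot> f = \<one> (source C f) \<and> f \<cdot> g = \<one> (target C f))" for C (structure)

text \<open>The tensor product is written \<open>\<odot>\<close> on objects and \<open>\<otimes>\<close> on morphisms.\<close>

record ('o, 'm) monoidal_cat = "('o, 'm) cat" +
  tensor_obj :: "'o \<Rightarrow> 'o \<Rightarrow> 'o" (infixr "\<odot>\<index>" 75)
  tensor_arr :: "'m \<Rightarrow> 'm \<Rightarrow> 'm" (infixr "\<otimes>\<index>" 75)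
  unit_obj :: "'o"
  associator :: "'o \<Rightarrow> 'o \<Rightarrow> 'o \<Rightarrow> 'm" ("\<alpha>\<index>")
  lunitor :: "'o \<Rightarrow> 'm"
  runitor :: "'o \<Rightarrow> 'm"

locale monoidal_category = category C for C (structure) +
  assumes unit_obj: "unit_obj C \<in> obj C"
    and tensor_obj: "\<lbrakk>A \<in> obj C; B \<in> obj C\<rbrakk> \<Longrightarrow> A \<odot> B \<in> obj C"
    and tensor_hom: "\<lbrakk>f \<in> hom C A B; g \<in> hom C A' B'\<rbrakk>
      \<Longrightarrow> f \<otimes> g \<in> hom C (A \<odot> A') (B \<odot> B')"
    and tensor_ident: "\<lbrakk>A \<in> obj C; B \<in> obj C\<rbrakk> \<Longrightarrow> \<one> A \<otimes> \<one> B = \<one> (A \<odot> B)"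
    and tensor_comp: "\<lbrakk>f \<in> hom C A B; g \<in> hom C B D; f' \<in> hom C A' B'; g' \<in> hom C B' D'\<rbrakk>
      \<Longrightarrow> (g \<cdot> f) \<otimes> (g' \<cdot> f') = (g \<otimes> g') \<cdot> (f \<otimes> f')"
    and associator_hom: "\<lbrakk>A \<in> obj C; B \<in> obj C; D \<in> obj C\<rbrakk>
      \<Longrightarrow> \<alpha> A B D \<in> hom C ((A \<odot> B) \<odot> D) (A \<odot> (B \<odot> D))"
    and associator_iso: "\<lbrakk>A \<in> obj C; B \<in> obj C; D \<in> obj C\<rbrakk> \<Longrightarrow> iso_arr C (\<alpha> A B D)"
    and associator_natural: "\<lbrakk>f \<in> hom C A A'; g \<in> hom C B B'; h \<in> hom C D D'\<rbrakk>
      \<Longrightarrow> \<alpha> A' B' D' \<cdot> ((f \<otimes> g) \<otimes> h) = (f \<otimes> (g \<otimes> h)) \<cdot> \<alpha> A B D"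
    and lunitor_hom: "A \<in> obj C \<Longrightarrow> lunitor C A \<in> hom C (unit_obj C \<odot> A) A"
    and lunitor_iso: "A \<in> obj C \<Longrightarrow> iso_arr C (lunitor C A)"
    and lunitor_natural: "f \<in> hom C A B
      \<Longrightarrow> lunitor C B \<cdot> (\<one> (unit_obj C) \<otimes> f) = f \<cdot> lunitor C A"
    and runitor_hom: "A \<in> obj C \<Longrightarrow> runitor C A \<in> hom C (A \<odot> unit_obj C) A"
    and runitor_iso: "A \<in> obj C \<Longrightarrow> iso_arr C (runitor C A)"
    and runitor_natural: "f \<in> hom C A B
      \<Longrightarrow> runitor C B \<cdot> (f \<otimes> \<one> (unit_obj C)) = f \<cdot> runitor C A"
    and pentagon: "\<lbrakk>A \<in> obj C; B \<in> obj C; D \<in> obj C; E \<in> obj C\<rbrakk>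
      \<Longrightarrow> (\<one> A \<otimes> \<alpha> B D E) \<cdot> \<alpha> A (B \<odot> D) E \<cdot> (\<alpha> A B D \<otimes> \<one> E)
        = \<alpha> A B (D \<odot> E) \<cdot> \<alpha> (A \<odot> B) D E"
    and triangle: "\<lbrakk>A \<in> obj C; B \<in> obj C\<rbrakk>
      \<Longrightarrow> (\<one> A \<otimes> lunitor C B) \<cdot> \<alpha> A (unit_obj C) B = runitor C A \<otimes> \<one> B"

record ('o, 'm) dagger_monoidal_cat = "('o, 'm) monoidal_cat" +
  dagger :: "'m \<Rightarrow> 'm" ("_\<^sup>\<dagger>\<index>" [1000] 999)

definition unitary :: "('o, 'm, 'z) dagger_monoidal_cat_scheme \<Rightarrow> 'm \<Rightarrow> bool" where
  "unitary C f \<longleftrightarrow> f \<in> arr C \<and>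
      f\<^sup>\<dagger> \<cdot> f = \<one> (source C f) \<and> f \<cdot> f\<^sup>\<dagger> = \<one> (target C f)" for C (structure)

locale dagger_monoidal_category = monoidal_category C for C (structure) +
  assumes dagger_hom: "f \<in> hom C A B \<Longrightarrow> f\<^sup>\<dagger> \<in> hom C B A"
    and dagger_ident: "A \<in> obj C \<Longrightarrow> (\<one> A)\<^sup>\<dagger> = \<one> A"
    and dagger_comp: "\<lbrakk>f \<in> hom C A B; g \<in> hom C B D\<rbrakk> \<Longrightarrow> (g \<cdot> f)\<^sup>\<dagger> = f\<^sup>\<dagger> \<cdot> g\<^sup>\<dagger>"
    and dagger_dagger: "f \<in> arr C \<Longrightarrow> (f\<^sup>\<dagger>)\<^sup>\<dagger> = f"
    and dagger_tensor: "\<lbrakk>f \<in> arr C; g \<in> arr C\<rbrakk> \<Longrightarrow> (f \<otimes> g)\<^sup>\<dagger> = f\<^sup>\<dagger> \<otimes> g\<^sup>\<dagger>"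
    and associator_unitary: "\<lbrakk>A \<in> obj C; B \<in> obj C; D \<in> obj C\<rbrakk> \<Longrightarrow> unitary C (\<alpha> A B D)"
    and lunitor_unitary: "A \<in> obj C \<Longrightarrow> unitary C (lunitor C A)"
    and runitor_unitary: "A \<in> obj C \<Longrightarrow> unitary C (runitor C A)"

text \<open>A representative of a morphism \<open>A \<rightarrow> B\<close> is a morphism \<open>f : A \<rightarrow> X \<odot> B\<close> together with
  the object \<open>X\<close>, which in general cannot be recovered from \<open>f\<close> and \<open>B\<close>.\<close>

definition cp_reps ::
    "('o, 'm, 'z) dagger_monoidal_cat_scheme \<Rightarrow> 'o \<Rightarrow> 'o \<Rightarrow> ('o \<times> 'm) set" where
  "cp_reps C A B = {(X, f). X \<in> obj C \<and> f \<in> hom C A (X \<odot> B)}" for C (structure)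

text \<open>\<open>(f\<^sup>\<dagger> \<otimes> 1\<^sub>Y) (1\<^sub>X \<otimes> k) (f \<otimes> 1\<^sub>Y) : A \<odot> Y \<rightarrow> A \<odot> Y\<close> for \<open>k : B \<odot> Y \<rightarrow> B \<odot> Y\<close>,
  with the associators made explicit.\<close>

definition cp_sandwich ::
    "('o, 'm, 'z) dagger_monoidal_cat_scheme \<Rightarrow> 'o \<Rightarrow> 'o \<Rightarrow> 'm \<Rightarrow> 'o \<times> 'm \<Rightarrow> 'm" where
  "cp_sandwich C B Y k x = (case x of (X, f) \<Rightarrow>
      (f\<^sup>\<dagger> \<otimes> \<one> Y) \<cdot> (\<alpha> X B Y)\<^sup>\<dagger> \<cdot> (\<one> X \<otimes> k) \<cdot> \<alpha> X B Y \<cdot> (f \<otimes> \<one> Y))" for C (structure)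

definition cp_rel ::
    "('o, 'm, 'z) dagger_monoidal_cat_scheme \<Rightarrow> 'o \<Rightarrow> 'o \<Rightarrow> (('o \<times> 'm) \<times> ('o \<times> 'm)) set" where
  "cp_rel C A B = {(x, y). x \<in> cp_reps C A B \<and> y \<in> cp_reps C A B \<and>
      (\<forall>Y \<in> obj C. \<forall>Z \<in> obj C. \<forall>h \<in> hom C (B \<odot> Y) Z.
        cp_sandwich C B Y (h\<^sup>\<dagger> \<cdot> h) x = cp_sandwich C B Y (h\<^sup>\<dagger> \<cdot> h) y)}" for C (structure)

text \<open>The composite of \<open>(X, f)\<close>, from \<open>A\<close> to \<open>B\<close>, and \<open>(Y, g)\<close>, from \<open>B\<close> to \<open>D\<close>.\<close>

definition cp_comp_rep ::
    "('o, 'm, 'z) dagger_monoidal_cat_scheme \<Rightarrow> 'o \<Rightarrow> 'o \<times> 'm \<Rightarrow> 'o \<times> 'm \<Rightarrow> 'o \<times> 'm" where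
  "cp_comp_rep C D y x = (case (y, x) of ((Y, g), (X, f)) \<Rightarrow>
      (X \<odot> Y, (\<alpha> X Y D)\<^sup>\<dagger> \<cdot> (\<one> X \<otimes> g) \<cdot> f))" for C (structure)

text \<open>Equivalence classes are tagged with source and target, so that hom-sets are disjoint.\<close>

datatype ('o, 'm) cp_arr = CPArr (cp_source: 'o) (cp_target: 'o) (cp_reps_of: "('o \<times> 'm) set")

definition cp_class ::
    "('o, 'm, 'z) dagger_monoidal_cat_scheme \<Rightarrow> 'o \<Rightarrow> 'o \<Rightarrow> 'o \<times> 'm \<Rightarrow> ('o, 'm) cp_arr" where
  "cp_class C A B x = CPArr A B (cp_rel C A B `` {x})"

text \<open>Composition takes the union of the classes of the composites of all representatives;
  this is a single class exactly when these composites are all equivalent.\<close>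

definition CP_inf ::
    "('o, 'm, 'z) dagger_monoidal_cat_scheme \<Rightarrow> ('o, ('o, 'm) cp_arr) cat" where
  "CP_inf C = \<lparr>
     obj = obj C,
     arr = {CPArr A B F | A B F. A \<in> obj C \<and> B \<in> obj C \<and> F \<in> cp_reps C A B // cp_rel C A B},
     source = cp_source,
     target = cp_target,
     ident = (\<lambda>A. cp_class C A A (unit_obj C, (lunitor C A)\<^sup>\<dagger>)),
     comp = (\<lambda>G F. CPArr (cp_source F) (cp_target G)
       (\<Union>x \<in> cp_reps_of F. \<Union>y \<in> cp_reps_of G.
          cp_rel C (cp_source F) (cp_target G) `` {cp_comp_rep C (cp_target G) y x}))\<rparr>"
  for C (structure)

end

theory Submission
  imports Defs
begin

text \<open>A representative \<open>x = (X, f)\<close> acts on endomorphisms \<open>k\<close> of \<open>B \<odot> Y\<close> by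
  \<open>S\<^sub>x k = e\<^sup>\<dagger> (1\<^sub>X \<otimes> k) e\<close>, where \<open>e = \<alpha> (f \<otimes> 1\<^sub>Y)\<close>. It sends endomorphisms of the form
  \<open>h\<^sup>\<dagger> h\<close> to endomorphisms of that form, and two representatives are equivalent iff their actions
  on those agree. By the pentagon, a composite representative acts by composing the actions, and by
  Kelly's unit coherence the identity representative acts trivially. Hence composition respects the
  equivalence, and associativity and unit laws are those of composition of functions.\<close>

section \<open>Typed calculus in a monoidal category\<close>

lemma in_hom_iff: "f \<in> hom C A B \<longleftrightarrow> f \<in> arr C \<and> source C f = A \<and> target C f = B"
  by (simp add: hom_def)

context category
begin

lemma comp_simps [simp]:
  assumes "f \<in> arr C" "g \<in> arr C" "source C g = target C f"
  shows "g \<cdot> f \<in> arr C" "source C (g \<cdot> f) = source C f" "target C (g \<cdot> f) = target C g"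
  using comp_hom[of f "source C f" "target C f" g "target C g"] assms by (simp_all add: in_hom_iff)

lemma ident_simps [simp]:
  assumes "A \<in> obj C"
  shows "\<one> A \<in> arr C" "source C (\<one> A) = A" "target C (\<one> A) = A"
  using ident_hom[OF assms] by (simp_all add: in_hom_iff)

lemma assoc:
  "\<lbrakk>f \<in> arr C; g \<in> arr C; h \<in> arr C; source C g = target C f; source C h = target C g\<rbrakk>
    \<Longrightarrow> (h \<cdot> g) \<cdot> f = h \<cdot> g \<cdot> f"
  by (rule comp_assoc) (auto simp: in_hom_iff)

lemma ident_left [simp]: "\<lbrakk>f \<in> arr C; target C f = B\<rbrakk> \<Longrightarrow> \<one> B \<cdot> f = f"
  by (rule ident_comp) (auto simp: in_hom_iff)

lemma ident_right [simp]: "\<lbrakk>f \<in> arr C; source C f = A\<rbrakk> \<Longrightarrow> f \<cdot> \<one> A = f"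
  by (rule comp_ident) (auto simp: in_hom_iff)

text \<open>Composing with the inverse on the right undoes \<open>i\<close>. The proof of unit
  coherence uses this three times to strip structure isomorphisms.\<close>

lemma iso_arr_cancel_right:
  assumes "iso_arr C i" "f \<in> hom C (target C i) B" "g \<in> hom C (target C i) B" "f \<cdot> i = g \<cdot> i"
  shows "f = g"
proof -
  obtain j where j: "j \<in> hom C (target C i) (source C i)" "i \<cdot> j = \<one> (target C i)"
    and i: "i \<in> hom C (source C i) (target C i)"
    using assms(1) by (auto simp: iso_arr_def in_hom_iff)
  have "f = (f \<cdot> i) \<cdot> j"
    unfolding comp_assoc[OF j(1) i assms(2)] j(2) comp_ident[OF assms(2)] ..
  also have "\<dots> = g"
    unfolding assms(4) comp_assoc[OF j(1) i assms(3)] j(2) comp_ident[OF assms(3)] ..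
  finally show "f = g" .
qed

end

context monoidal_category
begin

declare unit_obj [simp] tensor_obj [simp]

lemma tensor_simps [simp]:
  assumes "f \<in> arr C" "g \<in> arr C"
  shows "f \<otimes> g \<in> arr C" "source C (f \<otimes> g) = source C f \<odot> source C g"
    "target C (f \<otimes> g) = target C f \<odot> target C g"
  using tensor_hom[of f "source C f" "target C f" g "source C g" "target C g"] assms
  by (simp_all add: in_hom_iff)

lemma associator_simps [simp]:
  assumes "A \<in> obj C" "B \<in> obj C" "D \<in> obj C"
  shows "\<alpha> A B D \<in> arr C" "source C (\<alpha> A B D) = (A \<odot> B) \<odot> D"
    "target C (\<alpha> A B D) = A \<odot> B \<odot> D"
  using associator_hom[OF assms] by (simp_all add: in_hom_iff)

lemma lunitor_simps [simp]:
  assumes "A \<in> obj C"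
  shows "lunitor C A \<in> arr C" "source C (lunitor C A) = unit_obj C \<odot> A"
    "target C (lunitor C A) = A"
  using lunitor_hom[OF assms] by (simp_all add: in_hom_iff)

lemma runitor_simps [simp]:
  assumes "A \<in> obj C"
  shows "runitor C A \<in> arr C" "source C (runitor C A) = A \<odot> unit_obj C"
    "target C (runitor C A) = A"
  using runitor_hom[OF assms] by (simp_all add: in_hom_iff)

lemma interchange:
  assumes "f \<in> arr C" "g \<in> arr C" "f' \<in> arr C" "g' \<in> arr C"
    "source C g = target C f" "source C g' = target C f'"
  shows "(g \<otimes> g') \<cdot> (f \<otimes> f') = (g \<cdot> f) \<otimes> (g' \<cdot> f')"
  using assms by (intro tensor_comp[symmetric]) (auto simp: in_hom_iff)

text \<open>Functoriality of the tensor carries the inverse \<open>j\<close> of \<open>i\<close> to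
  the inverse \<open>j \<otimes> \<one> B\<close>. This allows the pentagon's factor of the form
  \<open>\<alpha> A B D \<otimes> \<one> E\<close> to be cancelled.\<close>

lemma iso_arr_tensor_ident:
  assumes "iso_arr C i" and B: "B \<in> obj C"
  shows "iso_arr C (i \<otimes> \<one> B)"
proof -
  obtain j where j: "j \<in> arr C" "source C j = target C i" "target C j = source C i"
      "j \<cdot> i = \<one> (source C i)" "i \<cdot> j = \<one> (target C i)" and i: "i \<in> arr C"
    using assms(1) by (auto simp: iso_arr_def in_hom_iff)
  have "(j \<otimes> \<one> B) \<cdot> (i \<otimes> \<one> B) = \<one> (source C i \<odot> B)"
    "(i \<otimes> \<one> B) \<cdot> (j \<otimes> \<one> B) = \<one> (target C i \<odot> B)"
    using i j B by (simp_all add: interchange tensor_ident source_obj target_obj)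
  then show ?thesis
    unfolding iso_arr_def using i j B
    by (intro conjI bexI[of _ "j \<otimes> \<one> B"]) (simp_all add: in_hom_iff)
qed

text \<open>Kelly's unit coherence: after tensoring with the unit on the left, both sides agree by the
  pentagon at \<open>I, I, B, E\<close> and the triangle, and \<open>1\<^sub>I \<otimes> -\<close> is faithful since \<open>\<lambda>\<close> is natural.\<close>

lemma lunitor_tensor:
  assumes B: "B \<in> obj C" and E: "E \<in> obj C"
  shows "lunitor C (B \<odot> E) \<cdot> \<alpha> (unit_obj C) B E = lunitor C B \<otimes> \<one> E"
proof -
  let ?I = "unit_obj C"
  let ?u = "lunitor C (B \<odot> E) \<cdot> \<alpha> ?I B E" and ?v = "lunitor C B \<otimes> \<one> E"
  note [simp] = B E
  have "(\<one> ?I \<otimes> ?u) \<cdot> \<alpha> ?I (?I \<odot> B) E \<cdot> (\<alpha> ?I ?I B \<otimes> \<one> E)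
      = (\<one> ?I \<otimes> lunitor C (B \<odot> E)) \<cdot> (\<one> ?I \<otimes> \<alpha> ?I B E) \<cdot> \<alpha> ?I (?I \<odot> B) E \<cdot> (\<alpha> ?I ?I B \<otimes> \<one> E)"
    by (simp add: assoc[symmetric] interchange)
  also have "\<dots> = ((\<one> ?I \<otimes> lunitor C (B \<odot> E)) \<cdot> \<alpha> ?I ?I (B \<odot> E)) \<cdot> \<alpha> (?I \<odot> ?I) B E"
    by (simp add: pentagon assoc)
  \<comment> \<open>The triangle is used twice: here at I and \<open>B \<odot> E\<close> to produce
    the right unitor of I, and two steps below at I and B to remove it again. The second use leaves
    the factor \<open>\<alpha> ?I ?I B \<otimes> \<one> E\<close> on the right, where the starting
    expression has it too.\<close>
  also have "\<dots> = (runitor C ?I \<otimes> (\<one> B \<otimes> \<one> E)) \<cdot> \<alpha> (?I \<odot> ?I) B E"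
    by (simp add: triangle tensor_ident)
  also have "\<dots> = \<alpha> ?I B E \<cdot> ((runitor C ?I \<otimes> \<one> B) \<otimes> \<one> E)"
    by (rule associator_natural[symmetric]) (simp_all add: in_hom_iff)
  also have "\<dots> = (\<alpha> ?I B E \<cdot> ((\<one> ?I \<otimes> lunitor C B) \<otimes> \<one> E)) \<cdot> (\<alpha> ?I ?I B \<otimes> \<one> E)"
    by (simp add: triangle[symmetric] interchange assoc)
  also have "\<alpha> ?I B E \<cdot> ((\<one> ?I \<otimes> lunitor C B) \<otimes> \<one> E) = (\<one> ?I \<otimes> ?v) \<cdot> \<alpha> ?I (?I \<odot> B) E"
    by (rule associator_natural) (simp_all add: in_hom_iff)
  finally have "((\<one> ?I \<otimes> ?u) \<cdot> \<alpha> ?I (?I \<odot> B) E) \<cdot> (\<alpha> ?I ?I B \<otimes> \<one> E)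
      = ((\<one> ?I \<otimes> ?v) \<cdot> \<alpha> ?I (?I \<odot> B) E) \<cdot> (\<alpha> ?I ?I B \<otimes> \<one> E)"
    by (simp add: assoc)
  then have "(\<one> ?I \<otimes> ?u) \<cdot> \<alpha> ?I (?I \<odot> B) E = (\<one> ?I \<otimes> ?v) \<cdot> \<alpha> ?I (?I \<odot> B) E"
    by (rule iso_arr_cancel_right[rotated 3])
       (simp_all add: in_hom_iff iso_arr_tensor_ident associator_iso)
  then have "\<one> ?I \<otimes> ?u = \<one> ?I \<otimes> ?v"
    by (rule iso_arr_cancel_right[rotated 3]) (simp_all add: in_hom_iff associator_iso)
  \<comment> \<open>Naturality of the left unitor rewrites
    \<open>?u \<cdot> lunitor C ((?I \<odot> B) \<odot> E)\<close> as the left unitor of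
    \<open>B \<odot> E\<close> after \<open>\<one> ?I \<otimes> ?u\<close>, and likewise for
    \<open>?v\<close>.\<close>
  then have "?u \<cdot> lunitor C ((?I \<odot> B) \<odot> E) = ?v \<cdot> lunitor C ((?I \<odot> B) \<odot> E)"
    using lunitor_natural[of ?u "(?I \<odot> B) \<odot> E" "B \<odot> E"] lunitor_natural[of ?v "(?I \<odot> B) \<odot> E" "B \<odot> E"]
    by (simp add: in_hom_iff)
  then show ?thesis
    by (rule iso_arr_cancel_right[rotated 3]) (simp_all add: in_hom_iff lunitor_iso)
qed

end

section \<open>The action of representatives\<close>

context dagger_monoidal_category
begin

lemma dagger_simps [simp]:
  assumes "f \<in> arr C"
  shows "f\<^sup>\<dagger> \<in> arr C" "source C (f\<^sup>\<dagger>) = target C f" "target C (f\<^sup>\<dagger>) = source C f" "(f\<^sup>\<dagger>)\<^sup>\<dagger> = f"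
  using dagger_hom[of f "source C f" "target C f"] assms dagger_dagger
  by (simp_all add: in_hom_iff)

declare dagger_ident [simp] dagger_tensor [simp]

lemma dagger_comp' [simp]:
  "\<lbrakk>f \<in> arr C; g \<in> arr C; source C g = target C f\<rbrakk> \<Longrightarrow> (g \<cdot> f)\<^sup>\<dagger> = f\<^sup>\<dagger> \<cdot> g\<^sup>\<dagger>"
  by (rule dagger_comp) (auto simp: in_hom_iff)

lemma associator_inverse [simp]:
  assumes "A \<in> obj C" "B \<in> obj C" "D \<in> obj C"
  shows "(\<alpha> A B D)\<^sup>\<dagger> \<cdot> \<alpha> A B D = \<one> ((A \<odot> B) \<odot> D)" "\<alpha> A B D \<cdot> (\<alpha> A B D)\<^sup>\<dagger> = \<one> (A \<odot> B \<odot> D)"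
  using associator_unitary[OF assms] assms by (simp_all add: unitary_def)

lemma lunitor_inverse [simp]:
  assumes "A \<in> obj C"
  shows "(lunitor C A)\<^sup>\<dagger> \<cdot> lunitor C A = \<one> (unit_obj C \<odot> A)" "lunitor C A \<cdot> (lunitor C A)\<^sup>\<dagger> = \<one> A"
  using lunitor_unitary[OF assms] assms by (simp_all add: unitary_def)

text \<open>The rebracketing isolates the ancilla X in front, so that an endomorphism k of
  \<open>B \<odot> Y\<close> can act as \<open>\<one> X \<otimes> k\<close>.\<close>

definition cp_extend :: "'a \<Rightarrow> 'a \<Rightarrow> 'a \<times> 'b \<Rightarrow> 'b" where
  "cp_extend B Y x = (case x of (X, f) \<Rightarrow> \<alpha> X B Y \<cdot> (f \<otimes> \<one> Y))"

lemma in_cp_reps_iff: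
  "(X, f) \<in> cp_reps C A B \<longleftrightarrow> X \<in> obj C \<and> f \<in> arr C \<and> source C f = A \<and> target C f = X \<odot> B"
  by (simp add: cp_reps_def in_hom_iff)

lemma cp_extend_simps [simp]:
  assumes "(X, f) \<in> cp_reps C A B" "B \<in> obj C" "Y \<in> obj C"
  shows "cp_extend B Y (X, f) \<in> arr C" "source C (cp_extend B Y (X, f)) = A \<odot> Y"
    "target C (cp_extend B Y (X, f)) = X \<odot> B \<odot> Y"
  using assms by (simp_all add: in_cp_reps_iff cp_extend_def)

lemma cp_sandwich_eq:
  assumes "(X, f) \<in> cp_reps C A B" "B \<in> obj C" "Y \<in> obj C" "k \<in> hom C (B \<odot> Y) (B \<odot> Y)"
  shows "cp_sandwich C B Y k (X, f)
    = (cp_extend B Y (X, f))\<^sup>\<dagger> \<cdot> (\<one> X \<otimes> k) \<cdot> cp_extend B Y (X, f)"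
  using assms by (simp add: in_cp_reps_iff in_hom_iff cp_extend_def cp_sandwich_def assoc)

text \<open>The factor \<open>\<one> X \<otimes> h\<close> is absorbed into the extension e of x,
  giving h' = (1 \<otimes> h) e with codomain \<open>X \<odot> Z\<close>. The equivalence of
  representatives only tests arguments of the form \<open>h\<^sup>\<dagger> \<cdot> h\<close>; this
  closure property lets the result of one action be fed to the next.\<close>

lemma cp_sandwich_square:
  assumes "x \<in> cp_reps C A B" "B \<in> obj C" "Y \<in> obj C" "Z \<in> obj C" "h \<in> hom C (B \<odot> Y) Z"
  obtains Z' h' where "Z' \<in> obj C" "h' \<in> hom C (A \<odot> Y) Z'"
    "cp_sandwich C B Y (h\<^sup>\<dagger> \<cdot> h) x = h'\<^sup>\<dagger> \<cdot> h'"
proof -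
  obtain X f where x: "x = (X, f)" by fastforce
  note xf = assms(1)[unfolded x]
  have X: "X \<in> obj C" and h: "h \<in> arr C" "source C h = B \<odot> Y" "target C h = Z"
    using xf assms(5) by (simp_all add: in_cp_reps_iff in_hom_iff)
  let ?e = "cp_extend B Y (X, f)"
  let ?h = "(\<one> X \<otimes> h) \<cdot> ?e"
  have "\<one> X \<otimes> (h\<^sup>\<dagger> \<cdot> h) = (\<one> X \<otimes> h\<^sup>\<dagger>) \<cdot> (\<one> X \<otimes> h)"
    using X h by (simp add: interchange)
  then have "cp_sandwich C B Y (h\<^sup>\<dagger> \<cdot> h) x = ?h\<^sup>\<dagger> \<cdot> ?h"
    using xf X h assms(2-4) by (simp add: x cp_sandwich_eq in_hom_iff assoc)
  then show thesis
    using xf X h assms(2-4) by (intro that[of "X \<odot> Z" ?h]) (simp_all add: in_hom_iff)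
qed

lemma cp_comp_rep_in_reps:
  assumes "D \<in> obj C" "x \<in> cp_reps C A B" "y \<in> cp_reps C B D"
  shows "cp_comp_rep C D y x \<in> cp_reps C A D"
  using assms by (cases x; cases y) (simp add: cp_comp_rep_def in_cp_reps_iff)

text \<open>Extending a composite means extending by f, then by g behind the ancilla X, and finally
  merging the ancillas X and Y. The pentagon accounts for the associators and naturality of \<alpha>
  moves g past them.\<close>

lemma cp_extend_comp_rep:
  assumes xf: "(X, f) \<in> cp_reps C A B" and yg: "(Y, g) \<in> cp_reps C B D"
    and [simp]: "B \<in> obj C" "D \<in> obj C" "W \<in> obj C"
  shows "cp_extend D W (cp_comp_rep C D (Y, g) (X, f))
    = (\<alpha> X Y (D \<odot> W))\<^sup>\<dagger> \<cdot> (\<one> X \<otimes> cp_extend D W (Y, g)) \<cdot> cp_extend B W (X, f)"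
proof -
  have [simp]: "X \<in> obj C" "Y \<in> obj C" "f \<in> arr C" "g \<in> arr C" "source C f = A"
    "target C f = X \<odot> B" "source C g = B" "target C g = Y \<odot> D"
    using xf yg by (simp_all add: in_cp_reps_iff)
  let ?a = "\<alpha> X Y (D \<odot> W)"
  \<comment> \<open>This is the pentagon at X, Y, D, W with two of its associators carried to the
    opposite sides, which unitarity permits.\<close>
  have pent: "?a\<^sup>\<dagger> \<cdot> (\<one> X \<otimes> \<alpha> Y D W) \<cdot> \<alpha> X (Y \<odot> D) W = \<alpha> (X \<odot> Y) D W \<cdot> ((\<alpha> X Y D)\<^sup>\<dagger> \<otimes> \<one> W)"
  proof -
    let ?m = "(\<one> X \<otimes> \<alpha> Y D W) \<cdot> \<alpha> X (Y \<odot> D) W"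
    have "?m = ?m \<cdot> (\<alpha> X Y D \<otimes> \<one> W) \<cdot> ((\<alpha> X Y D)\<^sup>\<dagger> \<otimes> \<one> W)"
      by (simp add: interchange tensor_ident)
    also have "\<dots> = ?a \<cdot> \<alpha> (X \<odot> Y) D W \<cdot> ((\<alpha> X Y D)\<^sup>\<dagger> \<otimes> \<one> W)"
      using arg_cong[OF pentagon[of X Y D W], of "\<lambda>t. t \<cdot> ((\<alpha> X Y D)\<^sup>\<dagger> \<otimes> \<one> W)"]
      by (simp add: assoc)
    finally have "?a\<^sup>\<dagger> \<cdot> ?m = (?a\<^sup>\<dagger> \<cdot> ?a) \<cdot> \<alpha> (X \<odot> Y) D W \<cdot> ((\<alpha> X Y D)\<^sup>\<dagger> \<otimes> \<one> W)"
      by (subst assoc) simp_all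
    then show ?thesis by simp
  qed
  \<comment> \<open>Sliding g past the associator brings \<open>g \<otimes> \<one> W\<close> next to
    \<open>\<alpha> Y D W\<close> behind X, where the two form the extension of
    \<open>(Y, g)\<close>.\<close>
  have nat: "\<alpha> X (Y \<odot> D) W \<cdot> ((\<one> X \<otimes> g) \<otimes> \<one> W) = (\<one> X \<otimes> (g \<otimes> \<one> W)) \<cdot> \<alpha> X B W"
    by (rule associator_natural) (simp_all add: in_hom_iff)
  have split: "((\<alpha> X Y D)\<^sup>\<dagger> \<cdot> (\<one> X \<otimes> g) \<cdot> f) \<otimes> \<one> W
      = ((\<alpha> X Y D)\<^sup>\<dagger> \<otimes> \<one> W) \<cdot> ((\<one> X \<otimes> g) \<otimes> \<one> W) \<cdot> (f \<otimes> \<one> W)"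
    by (simp add: interchange)
  have "cp_extend D W (cp_comp_rep C D (Y, g) (X, f))
      = (\<alpha> (X \<odot> Y) D W \<cdot> ((\<alpha> X Y D)\<^sup>\<dagger> \<otimes> \<one> W)) \<cdot> ((\<one> X \<otimes> g) \<otimes> \<one> W) \<cdot> (f \<otimes> \<one> W)"
    unfolding cp_extend_def cp_comp_rep_def prod.case split by (simp add: assoc)
  also have "\<dots> = ?a\<^sup>\<dagger> \<cdot> (\<one> X \<otimes> \<alpha> Y D W) \<cdot> (\<alpha> X (Y \<odot> D) W \<cdot> ((\<one> X \<otimes> g) \<otimes> \<one> W)) \<cdot> (f \<otimes> \<one> W)"
    unfolding pent[symmetric] by (simp add: assoc)
  also have "\<dots> = ?a\<^sup>\<dagger> \<cdot> ((\<one> X \<otimes> \<alpha> Y D W) \<cdot> (\<one> X \<otimes> (g \<otimes> \<one> W))) \<cdot> \<alpha> X B W \<cdot> (f \<otimes> \<one> W)"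
    unfolding nat by (simp add: assoc)
  also have "\<dots> = ?a\<^sup>\<dagger> \<cdot> (\<one> X \<otimes> cp_extend D W (Y, g)) \<cdot> cp_extend B W (X, f)"
    by (simp add: interchange cp_extend_def)
  finally show ?thesis .
qed

text \<open>The action is contravariant: y acts first, then x. The associator that merges the
  ancillas occurs on both sides of k and turns \<open>\<one> (X \<odot> Y) \<otimes> k\<close> into
  \<open>\<one> X \<otimes> (\<one> Y \<otimes> k)\<close>; everything behind X is then the sandwich
  by y. This works for every endomorphism k, not only for squares.\<close>

lemma cp_sandwich_comp_rep:
  assumes x: "x \<in> cp_reps C A B" and y: "y \<in> cp_reps C B D"
    and [simp]: "B \<in> obj C" "D \<in> obj C" "W \<in> obj C"
    and k: "k \<in> hom C (D \<odot> W) (D \<odot> W)"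
  shows "cp_sandwich C D W k (cp_comp_rep C D y x) = cp_sandwich C B W (cp_sandwich C D W k y) x"
proof -
  obtain X f Y g where xy: "x = (X, f)" "y = (Y, g)" by fastforce
  note xf = x[unfolded xy] and yg = y[unfolded xy]
  note [simp] = xf yg
  have [simp]: "X \<in> obj C" "Y \<in> obj C" "k \<in> arr C" "source C k = D \<odot> W" "target C k = D \<odot> W"
    using xf yg k by (simp_all add: in_cp_reps_iff in_hom_iff)
  define p where "p = cp_extend B W (X, f)"
  define q where "q = cp_extend D W (Y, g)"
  have p [simp]: "p \<in> arr C" "source C p = A \<odot> W" "target C p = X \<odot> B \<odot> W"
    and q [simp]: "q \<in> arr C" "source C q = B \<odot> W" "target C q = Y \<odot> D \<odot> W"
    using cp_extend_simps[OF xf] cp_extend_simps[OF yg] by (simp_all add: p_def q_def)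
  let ?a = "\<alpha> X Y (D \<odot> W)"
  \<comment> \<open>Naturality of \<alpha> in its third argument; unitarity then gives the
    conjugation formula \<open>conj\<close>.\<close>
  have "?a \<cdot> ((\<one> X \<otimes> \<one> Y) \<otimes> k) = (\<one> X \<otimes> (\<one> Y \<otimes> k)) \<cdot> ?a"
    by (rule associator_natural) (simp_all add: in_hom_iff)
  then have "?a \<cdot> (\<one> (X \<odot> Y) \<otimes> k) \<cdot> ?a\<^sup>\<dagger> = ((\<one> X \<otimes> (\<one> Y \<otimes> k)) \<cdot> ?a) \<cdot> ?a\<^sup>\<dagger>"
    by (simp add: assoc[symmetric] tensor_ident)
  also have "\<dots> = \<one> X \<otimes> (\<one> Y \<otimes> k)"
    by (simp add: assoc)
  finally have conj: "?a \<cdot> (\<one> (X \<odot> Y) \<otimes> k) \<cdot> ?a\<^sup>\<dagger> = \<one> X \<otimes> (\<one> Y \<otimes> k)" .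
  have ext: "cp_extend D W (cp_comp_rep C D y x) = ?a\<^sup>\<dagger> \<cdot> (\<one> X \<otimes> q) \<cdot> p"
    using cp_extend_comp_rep[OF xf yg] by (simp add: xy p_def q_def)
  have "cp_comp_rep C D y x \<in> cp_reps C A D"
    using x y by (intro cp_comp_rep_in_reps) simp_all
  then have "cp_sandwich C D W k (cp_comp_rep C D y x)
      = (cp_extend D W (cp_comp_rep C D y x))\<^sup>\<dagger> \<cdot> (\<one> (X \<odot> Y) \<otimes> k) \<cdot> cp_extend D W (cp_comp_rep C D y x)"
    using k by (simp add: xy cp_comp_rep_def cp_sandwich_eq)
  also have "\<dots> = p\<^sup>\<dagger> \<cdot> (\<one> X \<otimes> q\<^sup>\<dagger>) \<cdot> (?a \<cdot> (\<one> (X \<odot> Y) \<otimes> k) \<cdot> ?a\<^sup>\<dagger>) \<cdot> (\<one> X \<otimes> q) \<cdot> p"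
    unfolding ext by (simp add: assoc)
  also have "\<dots> = p\<^sup>\<dagger> \<cdot> ((\<one> X \<otimes> q\<^sup>\<dagger>) \<cdot> (\<one> X \<otimes> (\<one> Y \<otimes> k)) \<cdot> (\<one> X \<otimes> q)) \<cdot> p"
    unfolding conj by (simp add: assoc)
  also have "\<dots> = p\<^sup>\<dagger> \<cdot> (\<one> X \<otimes> (q\<^sup>\<dagger> \<cdot> (\<one> Y \<otimes> k) \<cdot> q)) \<cdot> p"
    by (simp add: interchange)
  also have "q\<^sup>\<dagger> \<cdot> (\<one> Y \<otimes> k) \<cdot> q = cp_sandwich C D W k y"
    by (simp add: xy cp_sandwich_eq[OF yg _ _ k] q_def)
  also have "p\<^sup>\<dagger> \<cdot> (\<one> X \<otimes> cp_sandwich C D W k y) \<cdot> p = cp_sandwich C B W (cp_sandwich C D W k y) x"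
  proof -
    have "cp_sandwich C D W k y \<in> hom C (B \<odot> W) (B \<odot> W)"
      by (simp add: xy cp_sandwich_eq[OF yg _ _ k] q_def[symmetric] in_hom_iff)
    then show ?thesis
      by (simp add: xy cp_sandwich_eq[OF xf] p_def)
  qed
  finally show ?thesis .
qed

abbreviation cp_ident_rep :: "'a \<Rightarrow> 'a \<times> 'b" where
  "cp_ident_rep A \<equiv> (unit_obj C, (lunitor C A)\<^sup>\<dagger>)"

lemma cp_ident_rep_in_reps: "A \<in> obj C \<Longrightarrow> cp_ident_rep A \<in> cp_reps C A A"
  by (simp add: in_cp_reps_iff)

text \<open>By unit coherence the extension of the identity representative is the dagger of the left
  unitor of \<open>A \<odot> Y\<close>. Naturality moves k through that unitor, and unitarity
  cancels what is left.\<close>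

lemma cp_sandwich_ident_rep:
  assumes [simp]: "A \<in> obj C" "Y \<in> obj C" and k: "k \<in> hom C (A \<odot> Y) (A \<odot> Y)"
  shows "cp_sandwich C A Y k (cp_ident_rep A) = k"
proof -
  let ?I = "unit_obj C"
  let ?l = "lunitor C (A \<odot> Y)" and ?a = "\<alpha> ?I A Y"
  have [simp]: "k \<in> arr C" "source C k = A \<odot> Y" "target C k = A \<odot> Y"
    using k by (simp_all add: in_hom_iff)
  \<comment> \<open>Taking daggers in \<open>lunitor_tensor\<close> gives
    \<open>?a\<^sup>\<dagger> \<cdot> ?l\<^sup>\<dagger>\<close> for the tensored unitor, and the
    associator in \<open>cp_extend\<close> cancels \<open>?a\<^sup>\<dagger>\<close>.\<close>
  have e: "cp_extend A Y (cp_ident_rep A) = ?l\<^sup>\<dagger>"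
  proof -
    have "(lunitor C A)\<^sup>\<dagger> \<otimes> \<one> Y = (lunitor C A \<otimes> \<one> Y)\<^sup>\<dagger>"
      by simp
    also have "\<dots> = ?a\<^sup>\<dagger> \<cdot> ?l\<^sup>\<dagger>"
      by (simp add: lunitor_tensor[symmetric] del: dagger_tensor)
    finally have "cp_extend A Y (cp_ident_rep A) = (?a \<cdot> ?a\<^sup>\<dagger>) \<cdot> ?l\<^sup>\<dagger>"
      by (simp add: cp_extend_def assoc del: associator_inverse)
    then show ?thesis by simp
  qed
  have "cp_sandwich C A Y k (cp_ident_rep A) = (?l \<cdot> (\<one> ?I \<otimes> k)) \<cdot> ?l\<^sup>\<dagger>"
    using cp_sandwich_eq[OF cp_ident_rep_in_reps[of A] _ _ k] by (simp add: e assoc)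
  also have "?l \<cdot> (\<one> ?I \<otimes> k) = k \<cdot> ?l"
    using k by (rule lunitor_natural)
  finally show ?thesis
    by (simp add: assoc)
qed

section \<open>The category of equivalence classes\<close>

lemma equiv_cp_rel: "equiv (cp_reps C A B) (cp_rel C A B)"
  by (rule equivI) (auto simp: cp_rel_def refl_on_def sym_def trans_def)

lemma cp_relI:
  assumes "x \<in> cp_reps C A B" "x' \<in> cp_reps C A B"
    and "\<And>Y Z h. \<lbrakk>Y \<in> obj C; Z \<in> obj C; h \<in> hom C (B \<odot> Y) Z\<rbrakk>
      \<Longrightarrow> cp_sandwich C B Y (h\<^sup>\<dagger> \<cdot> h) x = cp_sandwich C B Y (h\<^sup>\<dagger> \<cdot> h) x'"
  shows "(x, x') \<in> cp_rel C A B"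
  using assms by (simp add: cp_rel_def)

lemma square_in_hom: "h \<in> hom C A B \<Longrightarrow> h\<^sup>\<dagger> \<cdot> h \<in> hom C A A"
  by (auto simp: in_hom_iff)

text \<open>The composite acts as x applied to the result of y. Replacing y by y' leaves that inner
  result unchanged; replacing x by x' is legitimate because the inner result is again a square,
  hence an argument that the equivalence of x and x' covers.\<close>

lemma cp_comp_rep_cong:
  assumes B: "B \<in> obj C" and D: "D \<in> obj C"
    and xx': "(x, x') \<in> cp_rel C A B" and yy': "(y, y') \<in> cp_rel C B D"
  shows "(cp_comp_rep C D y x, cp_comp_rep C D y' x') \<in> cp_rel C A D"
proof -
  have x: "x \<in> cp_reps C A B" "x' \<in> cp_reps C A B" and y: "y \<in> cp_reps C B D" "y' \<in> cp_reps C B D"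
    using xx' yy' by (auto simp: cp_rel_def)
  show ?thesis
  proof (rule cp_relI)
    fix W Z h
    assume W: "W \<in> obj C" and Z: "Z \<in> obj C" and h: "h \<in> hom C (D \<odot> W) Z"
    let ?k = "h\<^sup>\<dagger> \<cdot> h"
    have k: "?k \<in> hom C (D \<odot> W) (D \<odot> W)"
      using h by (rule square_in_hom)
    obtain Z' h' where h': "Z' \<in> obj C" "h' \<in> hom C (B \<odot> W) Z'"
      "cp_sandwich C D W ?k y = h'\<^sup>\<dagger> \<cdot> h'"
      using cp_sandwich_square[OF y(1) D W Z h] by blast
    have "cp_sandwich C D W ?k (cp_comp_rep C D y x) = cp_sandwich C B W (cp_sandwich C D W ?k y) x"
      using x y B D W k by (intro cp_sandwich_comp_rep)
    also have "\<dots> = cp_sandwich C B W (cp_sandwich C D W ?k y) x'"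
      unfolding h'(3) using xx' W h' by (simp add: cp_rel_def)
    also have "cp_sandwich C D W ?k y = cp_sandwich C D W ?k y'"
      using yy' W Z h by (simp add: cp_rel_def)
    also have "cp_sandwich C B W (cp_sandwich C D W ?k y') x'
        = cp_sandwich C D W ?k (cp_comp_rep C D y' x')"
      using x y B D W k by (intro cp_sandwich_comp_rep[symmetric])
    finally show "cp_sandwich C D W ?k (cp_comp_rep C D y x)
        = cp_sandwich C D W ?k (cp_comp_rep C D y' x')" .
  qed (use x y D cp_comp_rep_in_reps in blast)+
qed

text \<open>Both bracketings act by z, then y, then x. They are compared only up to equivalence
  since their ancillas are bracketed differently, as \<open>X \<odot> (Y \<odot> Z)\<close> and
  \<open>(X \<odot> Y) \<odot> Z\<close>.\<close>

lemma cp_comp_rep_assoc: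
  assumes obj: "B \<in> obj C" "D \<in> obj C" "E \<in> obj C"
    and x: "x \<in> cp_reps C A B" and y: "y \<in> cp_reps C B D" and z: "z \<in> cp_reps C D E"
  shows "(cp_comp_rep C E (cp_comp_rep C E z y) x, cp_comp_rep C E z (cp_comp_rep C D y x))
    \<in> cp_rel C A E"
proof (rule cp_relI)
  have xy: "cp_comp_rep C D y x \<in> cp_reps C A D" and yz: "cp_comp_rep C E z y \<in> cp_reps C B E"
    using obj x y z by (blast intro: cp_comp_rep_in_reps)+
  show "cp_comp_rep C E (cp_comp_rep C E z y) x \<in> cp_reps C A E"
    "cp_comp_rep C E z (cp_comp_rep C D y x) \<in> cp_reps C A E"
    using obj x z xy yz by (blast intro: cp_comp_rep_in_reps)+
  fix W Z h
  assume W: "W \<in> obj C" and Z: "Z \<in> obj C" and h: "h \<in> hom C (E \<odot> W) Z"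
  have k: "h\<^sup>\<dagger> \<cdot> h \<in> hom C (E \<odot> W) (E \<odot> W)"
    using h by (rule square_in_hom)
  \<comment> \<open>The factorization serves as a typing argument: it shows that the action of z
    yields an endomorphism of \<open>D \<odot> W\<close>, as the composition law for x and y
    requires.\<close>
  obtain Z' h' where h': "h' \<in> hom C (D \<odot> W) Z'" "cp_sandwich C E W (h\<^sup>\<dagger> \<cdot> h) z = h'\<^sup>\<dagger> \<cdot> h'"
    using cp_sandwich_square[OF z obj(3) W Z h] by blast
  show "cp_sandwich C E W (h\<^sup>\<dagger> \<cdot> h) (cp_comp_rep C E (cp_comp_rep C E z y) x)
      = cp_sandwich C E W (h\<^sup>\<dagger> \<cdot> h) (cp_comp_rep C E z (cp_comp_rep C D y x))"
    by (simp add: cp_sandwich_comp_rep[OF x yz obj(1,3) W k] cp_sandwich_comp_rep[OF y z obj(2,3) W k]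
        cp_sandwich_comp_rep[OF xy z obj(2,3) W k] h'(2)
        cp_sandwich_comp_rep[OF x y obj(1,2) W square_in_hom[OF h'(1)]])
qed

text \<open>The composites have ancillas \<open>X \<odot> I\<close> and \<open>I \<odot> X\<close>
  instead of X, so they are only equivalent to x. The equivalence holds because the identity
  representative acts trivially, before or after x.\<close>

lemma cp_comp_rep_ident:
  assumes A: "A \<in> obj C" and B: "B \<in> obj C" and x: "x \<in> cp_reps C A B"
  shows "(cp_comp_rep C B (cp_ident_rep B) x, x) \<in> cp_rel C A B"
    and "(cp_comp_rep C B x (cp_ident_rep A), x) \<in> cp_rel C A B"
proof -
  note idA = cp_ident_rep_in_reps[OF A] and idB = cp_ident_rep_in_reps[OF B]
  show "(cp_comp_rep C B (cp_ident_rep B) x, x) \<in> cp_rel C A B"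
  proof (rule cp_relI)
    fix Y Z h
    assume Y: "Y \<in> obj C" and Z: "Z \<in> obj C" and h: "h \<in> hom C (B \<odot> Y) Z"
    show "cp_sandwich C B Y (h\<^sup>\<dagger> \<cdot> h) (cp_comp_rep C B (cp_ident_rep B) x)
        = cp_sandwich C B Y (h\<^sup>\<dagger> \<cdot> h) x"
      by (simp add: cp_sandwich_comp_rep[OF x idB B B Y square_in_hom[OF h]]
          cp_sandwich_ident_rep[OF B Y square_in_hom[OF h]])
  qed (use x idB B cp_comp_rep_in_reps in blast)+
  show "(cp_comp_rep C B x (cp_ident_rep A), x) \<in> cp_rel C A B"
  proof (rule cp_relI)
    fix Y Z h
    assume Y: "Y \<in> obj C" and Z: "Z \<in> obj C" and h: "h \<in> hom C (B \<odot> Y) Z"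
    \<comment> \<open>Here the identity acts on the result of x, which must first be seen to be an
      endomorphism of \<open>A \<odot> Y\<close>.\<close>
    obtain Z' h' where h': "h' \<in> hom C (A \<odot> Y) Z'" "cp_sandwich C B Y (h\<^sup>\<dagger> \<cdot> h) x = h'\<^sup>\<dagger> \<cdot> h'"
      using cp_sandwich_square[OF x B Y Z h] by blast
    show "cp_sandwich C B Y (h\<^sup>\<dagger> \<cdot> h) (cp_comp_rep C B x (cp_ident_rep A))
        = cp_sandwich C B Y (h\<^sup>\<dagger> \<cdot> h) x"
      by (simp add: cp_sandwich_comp_rep[OF idA x A B Y square_in_hom[OF h]] h'(2)
          cp_sandwich_ident_rep[OF A Y square_in_hom[OF h'(1)]])
  qed (use x idA B cp_comp_rep_in_reps in blast)+
qed

lemma cp_class_eq_iff: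
  "\<lbrakk>x \<in> cp_reps C A B; y \<in> cp_reps C A B\<rbrakk>
    \<Longrightarrow> cp_class C A B x = cp_class C A B y \<longleftrightarrow> (x, y) \<in> cp_rel C A B"
  by (simp add: cp_class_def eq_equiv_class_iff[OF equiv_cp_rel])

text \<open>By congruence all pairs of representatives contribute the same class, so the union
  defining composition in \<open>CP_inf\<close> collapses to it.\<close>

lemma cp_class_comp:
  assumes B: "B \<in> obj C" and D: "D \<in> obj C"
    and x: "x \<in> cp_reps C A B" and y: "y \<in> cp_reps C B D"
  shows "cp_class C B D y \<cdot>\<^bsub>CP_inf C\<^esub> cp_class C A B x = cp_class C A D (cp_comp_rep C D y x)"
proof -
  let ?c = "\<lambda>x y. cp_rel C A D `` {cp_comp_rep C D y x}"
  have "congruent2 (cp_rel C A B) (cp_rel C B D) ?c"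
    using cp_comp_rep_cong[OF B D] equiv_class_eq[OF equiv_cp_rel]
    by (intro congruent2I') blast
  then show ?thesis
    using UN_equiv_class2[OF equiv_cp_rel equiv_cp_rel _ x y, of ?c]
    by (simp add: CP_inf_def cp_class_def)
qed

lemma CP_inf_arr_iff:
  "F \<in> arr (CP_inf C) \<longleftrightarrow> (\<exists>A B x. A \<in> obj C \<and> B \<in> obj C \<and> x \<in> cp_reps C A B \<and> F = cp_class C A B x)"
  by (auto simp: CP_inf_def cp_class_def quotient_def)

lemma CP_inf_hom_iff:
  "F \<in> hom (CP_inf C) A B \<longleftrightarrow>
    A \<in> obj C \<and> B \<in> obj C \<and> (\<exists>x \<in> cp_reps C A B. F = cp_class C A B x)"
proof -
  \<comment> \<open>The tags stored in a class determine its source and target, so a class lying in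
    a given hom-set has its representative in the matching \<open>cp_reps\<close>.\<close>
  have "source (CP_inf C) (cp_class C A' B' x) = A'" "target (CP_inf C) (cp_class C A' B' x) = B'"
    for A' B' x
    by (simp_all add: CP_inf_def cp_class_def)
  then show ?thesis
    by (auto simp: in_hom_iff CP_inf_arr_iff)
qed

text \<open>Each axiom is checked on representatives: \<open>CP_inf_hom_iff\<close> supplies them,
  \<open>cp_class_comp\<close> moves composition onto them, and their equivalences become equalities
  of classes.\<close>

lemma category_CP_inf: "category (CP_inf C)"
proof
  have obj [simp]: "obj (CP_inf C) = obj C"
    and ident [simp]: "\<one>\<^bsub>CP_inf C\<^esub> A = cp_class C A A (cp_ident_rep A)" for A
    by (simp_all add: CP_inf_def)
  show "source (CP_inf C) F \<in> obj (CP_inf C)" "target (CP_inf C) F \<in> obj (CP_inf C)"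
    if "F \<in> arr (CP_inf C)" for F
    using that by (auto simp: CP_inf_def)
  show "\<one>\<^bsub>CP_inf C\<^esub> A \<in> hom (CP_inf C) A A" if "A \<in> obj (CP_inf C)" for A
    using that cp_ident_rep_in_reps by (auto simp: CP_inf_hom_iff)
  show "G \<cdot>\<^bsub>CP_inf C\<^esub> F \<in> hom (CP_inf C) A D"
    if "F \<in> hom (CP_inf C) A B" "G \<in> hom (CP_inf C) B D" for F G A B D
    using that by (auto simp: CP_inf_hom_iff cp_class_comp intro: cp_comp_rep_in_reps)
  show "(H \<cdot>\<^bsub>CP_inf C\<^esub> G) \<cdot>\<^bsub>CP_inf C\<^esub> F = H \<cdot>\<^bsub>CP_inf C\<^esub> G \<cdot>\<^bsub>CP_inf C\<^esub> F"
    if homs: "F \<in> hom (CP_inf C) A B" "G \<in> hom (CP_inf C) B D" "H \<in> hom (CP_inf C) D E" for F G H A B D E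
  proof -
    obtain x y z where xyz: "x \<in> cp_reps C A B" "y \<in> cp_reps C B D" "z \<in> cp_reps C D E"
      and FGH: "F = cp_class C A B x" "G = cp_class C B D y" "H = cp_class C D E z"
      and objs: "B \<in> obj C" "D \<in> obj C" "E \<in> obj C"
      using homs unfolding CP_inf_hom_iff by blast
    have "cp_comp_rep C D y x \<in> cp_reps C A D" "cp_comp_rep C E z y \<in> cp_reps C B E"
      using xyz objs by (blast intro: cp_comp_rep_in_reps)+
    moreover have "cp_class C A E (cp_comp_rep C E (cp_comp_rep C E z y) x)
        = cp_class C A E (cp_comp_rep C E z (cp_comp_rep C D y x))"
      using cp_comp_rep_assoc[OF objs xyz] by (simp add: cp_class_def equiv_class_eq[OF equiv_cp_rel])
    ultimately show ?thesis
      using xyz objs by (simp add: FGH cp_class_comp)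
  qed
  show "\<one>\<^bsub>CP_inf C\<^esub> B \<cdot>\<^bsub>CP_inf C\<^esub> F = F" "F \<cdot>\<^bsub>CP_inf C\<^esub> \<one>\<^bsub>CP_inf C\<^esub> A = F"
    if "F \<in> hom (CP_inf C) A B" for F A B
    using that cp_ident_rep_in_reps[of A] cp_ident_rep_in_reps[of B]
    by (auto simp: CP_inf_hom_iff cp_class_comp cp_comp_rep_in_reps cp_class_eq_iff cp_comp_rep_ident)
qed

end

text \<open>Composition in \<open>CP_inf\<close> is encoded by a union, so independence of
  representatives is not visible in the category axioms. The first three conjuncts therefore state
  it separately, and tie the encoded composition to the one on representatives.\<close>

theorem proposition4:
  fixes C :: "('o, 'm, 'z) dagger_monoidal_cat_scheme"
  assumes "dagger_monoidal_category C"
  shows "(\<forall>A \<in> obj C. \<forall>B \<in> obj C. equiv (cp_reps C A B) (cp_rel C A B))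
    \<and> (\<forall>A \<in> obj C. \<forall>B \<in> obj C. \<forall>D \<in> obj C. \<forall>x x' y y'.
        (x, x') \<in> cp_rel C A B \<longrightarrow> (y, y') \<in> cp_rel C B D \<longrightarrow>
        (cp_comp_rep C D y x, cp_comp_rep C D y' x') \<in> cp_rel C A D)
    \<and> (\<forall>A \<in> obj C. \<forall>B \<in> obj C. \<forall>D \<in> obj C. \<forall>x \<in> cp_reps C A B. \<forall>y \<in> cp_reps C B D.
        cp_class C B D y \<cdot>\<^bsub>CP_inf C\<^esub> cp_class C A B x = cp_class C A D (cp_comp_rep C D y x))
    \<and> category (CP_inf C)"
proof -
  interpret dagger_monoidal_category C by fact
  show ?thesis
    using equiv_cp_rel cp_comp_rep_cong cp_class_comp category_CP_inf by blast
qed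

end
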